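(* Let $(\xi_t, X_\tau)$ be a cyclic-independent conjugate process. Assume that $(\xi_t)$ is ergodic, in the sense that $\lim_{n\to\infty}\frac1n\sum_{t=0}^{n-1}\xi_t=\mathbb{E}\xi_0$ almost surely (convergence in $M_1(\mathbb{R})$). Then, for any sequence $(\tau_i)_{i\ge 0}$ with $\tau_i\in[i,i+1)$ and any continuous bounded function $f\colon\mathbb{R}\to\mathbb{R}$, it holds that $$\lim_{n\to\infty}\frac1n\sum_{i=0}^{n-1} f\circ X_{\tau_i}=\mathbb{E}\, f\circ X_0$$ in probability.
   Context: Let $(\Omega,\mathscr{A},\mathbb{P})$ be a probability space and let $M_1(\mathbb{R})$ be the set of Borel probability measures on $\mathbb{R}$ with the topology of weak convergence (tested against continuous bounded functions). Standing assumption: $(\xi_t : t=0,1,\dots)$ is a (strictly) stationary sequence of random elements of $M_1(\mathbb{R})$. Put $\Xi:=\sigma(\xi_0,\xi_1,\dots)$. The baricenter $\mathbb{E}\xi_0$ is the unique element of $M_1(\mathbb{R})$ with $\mathbb{E}\int f\,d\xi_0=\int f\,d\mathbb{E}\xi_0$ for all continuous bounded $f\colon\mathbb{R}\to\mathbb{R}$. Conjugate process: a pair $(\xi_t,X_\tau)$ where $(X_\tau:\tau\ge 0)$ is a real-valued stochastic process on $\Omega$ such that for every Borel set $B\subset\mathbb{R}$, every $t=0,1,\dots$ and every $\tau\in[t,t+1)$, $\mathbb{P}[X_\tau\in B\mid\Xi]=\xi_t(B)$ almost surely. Cyclic-independent: conditionally on $\Xi$, the processes $(X_\tau:\tau\in[0,1)),(X_\tau:\tau\in[1,2)),\dots,(X_\tau:\tau\in[t,t+1)),\dots$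 form an independent sequence. *)

theory Defs
  imports "HOL-Probability.Probability"
begin

definition weak_topology :: "real measure topology" where
  "weak_topology = topology_generated_by
     {{\<mu> \<in> space (prob_algebra borel). (\<integral>x. f x \<partial>\<mu>) \<in> U} | f U.
        continuous_on UNIV (f :: real \<Rightarrow> real) \<and> bounded (range f) \<and> open (U :: real set)}"

definition borel_of_topology :: "'b topology \<Rightarrow> 'b measure" where
  "borel_of_topology T = sigma (topspace T) {U. openin T U}"

definition M1 :: "real measure measure" where
  "M1 = borel_of_topology weak_topology"

text \<open>The arithmetic mean of the first \<open>n\<close> measures; only \<open>n > 0\<close> is meaningful.\<close>

definition measure_average :: "nat \<Rightarrow> (nat \<Rightarrow> real measure) \<Rightarrow> real measure" where
  "measure_average n \<nu> =
     measure_of UNIV (sets borel) (\<lambda>B. (\<Sum>t<n. emeasure (\<nu> t) B) / of_nat n)"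

definition barycenter :: "'a measure \<Rightarrow> ('a \<Rightarrow> real measure) \<Rightarrow> real measure" where
  "barycenter M \<xi> = (THE \<mu>. \<mu> \<in> space M1 \<and>
     (\<forall>f :: real \<Rightarrow> real. continuous_on UNIV f \<and> bounded (range f) \<longrightarrow>
        (\<integral>\<omega>. (\<integral>x. f x \<partial>\<xi> \<omega>) \<partial>M) = (\<integral>x. f x \<partial>\<mu>)))"

definition generated_algebra ::
    "'a set \<Rightarrow> 'i set \<Rightarrow> 'b measure \<Rightarrow> ('i \<Rightarrow> 'a \<Rightarrow> 'b) \<Rightarrow> 'a measure" where
  "generated_algebra \<Omega> I N Y = sigma \<Omega> (\<Union>i\<in>I. {Y i -` A \<inter> \<Omega> | A. A \<in> sets N})"

definition stationary_sequence :: "'a measure \<Rightarrow> 'b measure \<Rightarrow> (nat \<Rightarrow> 'a \<Rightarrow> 'b) \<Rightarrow> bool" where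
  "stationary_sequence M N \<xi> \<longleftrightarrow>
     (\<forall>t. \<xi> t \<in> measurable M N) \<and>
     (\<forall>k. distr M (Pi\<^sub>M UNIV (\<lambda>_. N)) (\<lambda>\<omega> t. \<xi> (t + k) \<omega>) =
          distr M (Pi\<^sub>M UNIV (\<lambda>_. N)) (\<lambda>\<omega> t. \<xi> t \<omega>))"

definition cond_prob_given :: "'a measure \<Rightarrow> 'a measure \<Rightarrow> 'a set \<Rightarrow> 'a \<Rightarrow> real" where
  "cond_prob_given M G A = real_cond_exp M G (indicator A)"

text \<open>The conditional counterpart of \<^const>\<open>prob_space.indep_sets\<close>.\<close>

definition cond_indep_sets ::
    "'a measure \<Rightarrow> 'a measure \<Rightarrow> ('i \<Rightarrow> 'a set set) \<Rightarrow> 'i set \<Rightarrow> bool" where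
  "cond_indep_sets M G F I \<longleftrightarrow>
     (\<forall>i\<in>I. F i \<subseteq> sets M) \<and>
     (\<forall>J\<subseteq>I. J \<noteq> {} \<longrightarrow> finite J \<longrightarrow> (\<forall>A\<in>Pi J F.
        AE \<omega> in M. cond_prob_given M G (\<Inter>j\<in>J. A j) \<omega> =
                    (\<Prod>j\<in>J. cond_prob_given M G (A j) \<omega>)))"

text \<open>The time set of \<open>X\<close> is \<open>{0..}\<close>; its values at negative times are irrelevant.\<close>

definition conjugate_process ::
    "'a measure \<Rightarrow> (nat \<Rightarrow> 'a \<Rightarrow> real measure) \<Rightarrow> (real \<Rightarrow> 'a \<Rightarrow> real) \<Rightarrow> bool" where
  "conjugate_process M \<xi> X \<longleftrightarrow>
     (\<forall>\<tau>\<ge>0. X \<tau> \<in> borel_measurable M) \<and>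
     (\<forall>B\<in>sets borel. \<forall>t. \<forall>\<tau>\<in>{real t..<real t + 1}.
        AE \<omega> in M. cond_prob_given M (generated_algebra (space M) UNIV M1 \<xi>)
                      (X \<tau> -` B \<inter> space M) \<omega> = measure (\<xi> t \<omega>) B)"

definition cyclic_independent ::
    "'a measure \<Rightarrow> (nat \<Rightarrow> 'a \<Rightarrow> real measure) \<Rightarrow> (real \<Rightarrow> 'a \<Rightarrow> real) \<Rightarrow> bool" where
  "cyclic_independent M \<xi> X \<longleftrightarrow>
     cond_indep_sets M (generated_algebra (space M) UNIV M1 \<xi>)
       (\<lambda>t::nat. sets (generated_algebra (space M) {real t..<real t + 1} borel X)) UNIV"

text \<open>Ergodicity in the sense of the law of large numbers for the random measures themselves.\<close>

definition ergodic_measures :: "'a measure \<Rightarrow> (nat \<Rightarrow> 'a \<Rightarrow> real measure) \<Rightarrow> bool" where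
  "ergodic_measures M \<xi> \<longleftrightarrow>
     (AE \<omega> in M. limitin weak_topology (\<lambda>n. measure_average n (\<lambda>t. \<xi> t \<omega>))
                    (barycenter M (\<xi> 0)) sequentially)"

definition converges_in_probability ::
    "'a measure \<Rightarrow> (nat \<Rightarrow> 'a \<Rightarrow> real) \<Rightarrow> ('a \<Rightarrow> real) \<Rightarrow> bool" where
  "converges_in_probability M Y Z \<longleftrightarrow>
     (\<forall>\<epsilon>>0. (\<lambda>n. measure M {\<omega> \<in> space M. \<bar>Y n \<omega> - Z \<omega>\<bar> > \<epsilon>}) \<longlonglongrightarrow> 0)"

lemma topspace_weak_topology: "topspace weak_topology = space (prob_algebra borel)"
proof -
  have "space (prob_algebra borel) \<in> {{\<mu> \<in> space (prob_algebra borel). (\<integral>x. f x \<partial>\<mu>) \<in> U} | f U.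
        continuous_on UNIV (f :: real \<Rightarrow> real) \<and> bounded (range f) \<and> open (U :: real set)}"
    by (rule CollectI, rule exI[of _ "\<lambda>_. 0"], rule exI[of _ UNIV]) auto
  then show ?thesis
    unfolding weak_topology_def topology_generated_by_topspace by auto
qed

lemma space_M1: "space M1 = {\<mu>. prob_space \<mu> \<and> sets \<mu> = sets borel}"
  by (simp add: M1_def borel_of_topology_def space_measure_of_conv topspace_weak_topology
      space_prob_algebra) auto

lemma sets_M1: "sets M1 = sigma_sets (space (prob_algebra borel)) {U. openin weak_topology U}"
  unfolding M1_def borel_of_topology_def topspace_weak_topology[symmetric]
  by (rule sets_measure_of) (auto dest: openin_subset)

lemma limitin_weak_topology_iff:
  assumes "\<forall>\<^sub>F n in F. \<mu> n \<in> space M1" "\<nu> \<in> space M1"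
  shows "limitin weak_topology \<mu> \<nu> F \<longleftrightarrow>
    (\<forall>f :: real \<Rightarrow> real. continuous_on UNIV f \<and> bounded (range f) \<longrightarrow>
       ((\<lambda>n. \<integral>x. f x \<partial>\<mu> n) \<longlongrightarrow> (\<integral>x. f x \<partial>\<nu>)) F)"
proof -
  let ?P = "space (prob_algebra borel) :: real measure set"
  let ?S = "{{\<mu> \<in> ?P. (\<integral>x. f x \<partial>\<mu>) \<in> U} | f U.
        continuous_on UNIV (f :: real \<Rightarrow> real) \<and> bounded (range f) \<and> open (U :: real set)}"
  have P: "\<nu> \<in> ?P" "\<forall>\<^sub>F n in F. \<mu> n \<in> ?P"
    using assms by (auto simp: space_M1 space_prob_algebra conj_commute)
  show ?thesis
  proof safe
    fix f :: "real \<Rightarrow> real" assume L: "limitin weak_topology \<mu> \<nu> F"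
      and f: "continuous_on UNIV f" "bounded (range f)"
    show "((\<lambda>n. \<integral>x. f x \<partial>\<mu> n) \<longlongrightarrow> (\<integral>x. f x \<partial>\<nu>)) F"
    proof (rule topological_tendstoI)
      fix U assume U: "open U" "(\<integral>x. f x \<partial>\<nu>) \<in> U"
      have "openin weak_topology {\<mu> \<in> ?P. (\<integral>x. f x \<partial>\<mu>) \<in> U}"
        unfolding weak_topology_def using f U by (intro topology_generated_by_Basis) blast
      with L U P have "\<forall>\<^sub>F n in F. \<mu> n \<in> {\<mu> \<in> ?P. (\<integral>x. f x \<partial>\<mu>) \<in> U}"
        unfolding limitin_def by blast
      then show "\<forall>\<^sub>F n in F. (\<integral>x. f x \<partial>\<mu> n) \<in> U" by eventually_elim auto
    qed
  next
    assume L: "\<forall>f :: real \<Rightarrow> real. continuous_on UNIV f \<and> bounded (range f) \<longrightarrow>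
       ((\<lambda>n. \<integral>x. f x \<partial>\<mu> n) \<longlongrightarrow> (\<integral>x. f x \<partial>\<nu>)) F"
    have "\<nu> \<in> V \<Longrightarrow> \<forall>\<^sub>F n in F. \<mu> n \<in> V" if "generate_topology_on ?S V" for V
      using that
    proof induction
      case Empty then show ?case by simp
    next
      case (Int a b) then show ?case by (auto intro: eventually_conj)
    next
      case (UN K)
      then obtain k where "k \<in> K" "\<nu> \<in> k" by blast
      with UN have "\<forall>\<^sub>F n in F. \<mu> n \<in> k" by blast
      then show ?case by eventually_elim (use \<open>k \<in> K\<close> in blast)
    next
      case (Basis s)
      then obtain f U where s: "s = {\<mu> \<in> ?P. (\<integral>x. f x \<partial>\<mu>) \<in> U}" "open U"
        "continuous_on UNIV (f :: real \<Rightarrow> real)" "bounded (range f)" by blast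
      with L Basis have "\<forall>\<^sub>F n in F. (\<integral>x. f x \<partial>\<mu> n) \<in> U"
        by (auto dest: topological_tendstoD)
      with P(2) show ?case by eventually_elim (auto simp: s)
    qed
    then show "limitin weak_topology \<mu> \<nu> F"
      using P unfolding limitin_def topspace_weak_topology
      by (auto simp: weak_topology_def openin_topology_generated_by_iff)
  qed
qed

lemma measure_average_sets [simp]: "sets (measure_average n \<nu>) = sets borel"
  unfolding measure_average_def using sets.sigma_sets_eq[of "borel :: real measure"]
  by (subst sets_measure_of) auto

lemma emeasure_measure_average:
  assumes "\<And>t. t < n \<Longrightarrow> sets (\<nu> t) = sets borel" "B \<in> sets borel"
  shows "emeasure (measure_average n \<nu>) B = (\<Sum>t<n. emeasure (\<nu> t) B) / of_nat n"
  unfolding measure_average_def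
proof (rule emeasure_measure_of_sigma)
  show "sigma_algebra UNIV (sets (borel :: real measure))"
    using sets.sigma_algebra_axioms[of "borel :: real measure"] by simp
  show "positive (sets borel) (\<lambda>B. (\<Sum>t<n. emeasure (\<nu> t) B) / of_nat n)"
    by (simp add: positive_def)
  show "countably_additive (sets borel) (\<lambda>B. (\<Sum>t<n. emeasure (\<nu> t) B) / of_nat n)"
  proof (rule countably_additiveI)
    fix A :: "nat \<Rightarrow> real set" assume A: "range A \<subseteq> sets borel" "disjoint_family A"
    have "(\<Sum>i. (\<Sum>t<n. emeasure (\<nu> t) (A i)) / of_nat n) =
        (\<Sum>i. \<Sum>t<n. emeasure (\<nu> t) (A i)) / of_nat n"
      by (simp add: divide_ennreal_def)
    also have "(\<Sum>i. \<Sum>t<n. emeasure (\<nu> t) (A i)) = (\<Sum>t<n. \<Sum>i. emeasure (\<nu> t) (A i))"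
      by (rule suminf_sum) simp
    also have "\<dots> = (\<Sum>t<n. emeasure (\<nu> t) (\<Union>i. A i))"
      using A assms(1) by (intro sum.cong refl suminf_emeasure) auto
    finally show "(\<Sum>i. (\<Sum>t<n. emeasure (\<nu> t) (A i)) / of_nat n) =
      (\<Sum>t<n. emeasure (\<nu> t) (\<Union>i. A i)) / of_nat n" .
  qed
qed fact

lemma measure_average_in_M1:
  assumes "n > 0" "\<And>t. t < n \<Longrightarrow> \<nu> t \<in> space M1"
  shows "measure_average n \<nu> \<in> space M1"
proof -
  have s: "sets (\<nu> t) = sets borel" "prob_space (\<nu> t)" if "t < n" for t
    using assms(2)[OF that] by (auto simp: space_M1)
  have "emeasure (\<nu> t) UNIV = 1" if "t < n" for t
    using prob_space.emeasure_space_1[OF s(2)[OF that]] sets_eq_imp_space_eq[OF s(1)[OF that]]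
    by simp
  then have "emeasure (measure_average n \<nu>) UNIV = 1"
    using s assms(1) by (subst emeasure_measure_average)
      (auto intro!: ennreal_divide_self simp: of_nat_less_top)
  moreover have "space (measure_average n \<nu>) = UNIV"
    using sets_eq_imp_space_eq[OF measure_average_sets[of n \<nu>]] by simp
  ultimately show ?thesis
    by (auto simp: space_M1 intro: prob_spaceI)
qed

lemma measurable_integral_M1:
  fixes f :: "real \<Rightarrow> real"
  assumes "continuous_on UNIV f" "bounded (range f)"
  shows "(\<lambda>\<mu>. \<integral>x. f x \<partial>\<mu>) \<in> borel_measurable M1"
proof (rule borel_measurableI)
  fix U :: "real set" assume U: "open U"
  have "openin weak_topology {\<mu> \<in> space (prob_algebra borel). (\<integral>x. f x \<partial>\<mu>) \<in> U}"
    unfolding weak_topology_def using assms U by (intro topology_generated_by_Basis) blast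
  moreover have "(\<lambda>\<mu>. \<integral>x. f x \<partial>\<mu>) -` U \<inter> space M1 =
      {\<mu> \<in> space (prob_algebra borel). (\<integral>x. f x \<partial>\<mu>) \<in> U}"
    by (auto simp: space_M1 space_prob_algebra)
  ultimately show "(\<lambda>\<mu>. \<integral>x. f x \<partial>\<mu>) -` U \<inter> space M1 \<in> sets M1"
    by (auto simp: sets_M1)
qed

lemma measurable_prob_algebra_of_M1:
  assumes "\<xi> \<in> measurable M M1"
  shows "\<xi> \<in> measurable M (prob_algebra borel)"
proof (rule measurable_prob_algebra_generated[where \<Omega>=UNIV and G="range atMost"])
  show "sets (borel :: real measure) = sigma_sets UNIV (range atMost)"
    by (subst borel_eq_atMost) (auto simp: sets_measure_of)
  show "Int_stable (range (atMost :: real \<Rightarrow> _))" by (auto simp: Int_stable_def)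
  fix \<omega> assume "\<omega> \<in> space M"
  then show "prob_space (\<xi> \<omega>)" "sets (\<xi> \<omega>) = sets borel"
    using measurable_space[OF assms] by (auto simp: space_M1)
next
  fix A :: "real set" assume "A \<in> range atMost"
  then obtain a where A: "A = {..a}" by auto
  let ?g = "\<lambda>n. cts_step a (a + 1 / real (Suc n))"
  have step_le: "\<bar>?g n x\<bar> \<le> 1" for n x
  proof -
    have "\<bar>cts_step a b x\<bar> \<le> 1" if "a < b" for b
    proof -
      have "(b - x) / (b - a) \<le> 1" if "\<not> x \<le> a"
        using that \<open>a < b\<close> by (simp add: divide_le_eq)
      moreover have "0 \<le> (b - x) / (b - a)" if "\<not> x \<ge> b"
        using that \<open>a < b\<close> by simp
      ultimately show ?thesis by (auto simp: cts_step_def)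
    qed
    then show ?thesis by simp
  qed
  have lim: "(\<lambda>n. \<integral>x. ?g n x \<partial>\<xi> \<omega>) \<longlonglongrightarrow> measure (\<xi> \<omega>) {..a}"
    if w: "\<omega> \<in> space M" for \<omega>
  proof -
    have s: "prob_space (\<xi> \<omega>)" "sets (\<xi> \<omega>) = sets borel"
      using measurable_space[OF assms w] by (auto simp: space_M1)
    interpret prob_space "\<xi> \<omega>" by fact
    have *: "(\<lambda>n. ?g n x) \<longlonglongrightarrow> indicator {..a} x" for x
    proof (cases "x \<le> a")
      case True then show ?thesis by (simp add: cts_step_def)
    next
      case False
      have "(\<lambda>n. 1 / real (Suc n)) \<longlonglongrightarrow> 0" by (rule LIMSEQ_Suc[OF lim_1_over_n])
      then have "\<forall>\<^sub>F n in sequentially. 1 / real (Suc n) < x - a"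
        using False by (intro order_tendstoD) auto
      then have "\<forall>\<^sub>F n in sequentially. ?g n x = 0"
        by eventually_elim (use False in \<open>auto simp: cts_step_def\<close>)
      then show ?thesis using False by (simp add: tendsto_eventually)
    qed
    have "(\<lambda>n. \<integral>x. ?g n x \<partial>\<xi> \<omega>) \<longlonglongrightarrow> (\<integral>x. indicator {..a} x \<partial>\<xi> \<omega>)"
    proof (rule integral_dominated_convergence[where w="\<lambda>_. 1"])
      show "?g n \<in> borel_measurable (\<xi> \<omega>)" for n
        unfolding measurable_cong_sets[OF s(2) refl]
        by (intro borel_measurable_continuous_onI cts_step_uniformly_continuous[THEN uniformly_continuous_imp_continuous]) simp
      show "AE x in \<xi> \<omega>. norm (?g n x) \<le> 1" for n
        using step_le by (intro AE_I2) simp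
    qed (use * s in \<open>auto simp: measurable_cong_sets[OF s(2) refl]\<close>)
    then show ?thesis using s sets_eq_imp_space_eq[OF s(2)] by simp
  qed
  have "(\<lambda>\<omega>. measure (\<xi> \<omega>) {..a}) \<in> borel_measurable M"
  proof (rule borel_measurable_LIMSEQ_real[OF lim])
    fix n
    have "bounded (range (?g n))"
      by (rule boundedI[of _ 1]) (use step_le in auto)
    then have "(\<lambda>\<mu>. \<integral>x. ?g n x \<partial>\<mu>) \<in> borel_measurable M1"
      by (intro measurable_integral_M1 cts_step_uniformly_continuous[THEN uniformly_continuous_imp_continuous]) auto
    from measurable_compose[OF assms this]
    show "(\<lambda>\<omega>. \<integral>x. ?g n x \<partial>\<xi> \<omega>) \<in> borel_measurable M" .
  qed
  moreover have "emeasure (\<xi> \<omega>) A = ennreal (measure (\<xi> \<omega>) {..a})" if "\<omega> \<in> space M" for \<omega>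
    using measurable_space[OF assms that] unfolding A
    by (auto simp: space_M1 finite_measure.emeasure_eq_measure prob_space.axioms(1) prob_space.finite_measure)
  ultimately show "(\<lambda>\<omega>. emeasure (\<xi> \<omega>) A) \<in> borel_measurable M"
    by (subst measurable_cong) auto
qed auto

lemma M1_eqI:
  assumes "\<mu> \<in> space M1" "\<nu> \<in> space M1"
    and eq: "\<And>f :: real \<Rightarrow> real. continuous_on UNIV f \<Longrightarrow> bounded (range f) \<Longrightarrow>
      (\<integral>x. f x \<partial>\<mu>) = (\<integral>x. f x \<partial>\<nu>)"
  shows "\<mu> = \<nu>"
proof (rule Levy_uniqueness)
  have s: "prob_space \<mu>" "sets \<mu> = sets borel" "prob_space \<nu>" "sets \<nu> = sets borel"
    using assms by (auto simp: space_M1)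
  then show rd: "real_distribution \<mu>" "real_distribution \<nu>"
    by (auto simp: real_distribution_def real_distribution_axioms_def
        dest: sets_eq_imp_space_eq)
  show "char \<mu> = char \<nu>"
  proof
    fix t :: real
    have b: "bounded (range (\<lambda>x. cos (t * x)))" "bounded (range (\<lambda>x. sin (t * x)))"
      by (auto intro!: boundedI[of _ 1])
    have i: "integrable \<mu> (\<lambda>x. iexp (t * x))" "integrable \<nu> (\<lambda>x. iexp (t * x))"
      using prob_space.integrable_iexp[OF s(1), of "\<lambda>x. complex_of_real (t * x)"]
        prob_space.integrable_iexp[OF s(3), of "\<lambda>x. complex_of_real (t * x)"]
      by (simp_all add: measurable_cong_sets[OF s(2) refl] measurable_cong_sets[OF s(4) refl])
    show "char \<mu> t = char \<nu> t"
      unfolding char_def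
    proof (rule complex_eqI)
      show "Re (CLINT x|\<mu>. iexp (t * x)) = Re (CLINT x|\<nu>. iexp (t * x))"
        unfolding integral_Re[OF i(1), symmetric] integral_Re[OF i(2), symmetric]
        using eq[OF _ b(1)] by (simp add: Re_exp continuous_intros)
      show "Im (CLINT x|\<mu>. iexp (t * x)) = Im (CLINT x|\<nu>. iexp (t * x))"
        unfolding integral_Im[OF i(1), symmetric] integral_Im[OF i(2), symmetric]
        using eq[OF _ b(2)] by (simp add: Im_exp continuous_intros)
    qed
  qed
qed

lemma barycenter_exists_unique:
  assumes "prob_space M" "\<xi> \<in> measurable M M1"
  shows "\<exists>!\<mu>. \<mu> \<in> space M1 \<and>
     (\<forall>f :: real \<Rightarrow> real. continuous_on UNIV f \<and> bounded (range f) \<longrightarrow>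
        (\<integral>\<omega>. (\<integral>x. f x \<partial>\<xi> \<omega>) \<partial>M) = (\<integral>x. f x \<partial>\<mu>))"
proof (rule ex_ex1I)
  interpret prob_space M by fact
  note K = measurable_prob_algebra_of_M1[OF assms(2)]
  note K' = measurable_prob_algebraD[OF K]
  have p: "prob_space (M \<bind> \<xi>)"
    by (rule prob_space_bind'[of _ M _ borel]) (use K in \<open>auto simp: space_prob_algebra assms(1)\<close>)
  have st: "sets (M \<bind> \<xi>) = sets borel"
    by (rule sets_bind_measurable[OF K' not_empty])
  have "(\<integral>\<omega>. (\<integral>x. f x \<partial>\<xi> \<omega>) \<partial>M) = (\<integral>x. f x \<partial>(M \<bind> \<xi>))"
    if f: "continuous_on UNIV f" "bounded (range f)" for f :: "real \<Rightarrow> real"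
  proof -
    obtain C where C: "\<And>x. \<bar>f x\<bar> \<le> C" using f(2) by (auto simp: bounded_iff)
    have f': "f \<in> borel_measurable borel" using f(1) by (rule borel_measurable_continuous_onI)
    show ?thesis
    proof (rule integral_bind[OF f' _ K', of C 1, symmetric])
      show "AE \<omega> in M. emeasure (\<xi> \<omega>) (space (\<xi> \<omega>)) \<le> ennreal 1"
        using measurable_space[OF K']
        by (intro AE_I2) (auto simp: space_subprob_algebra subprob_space.emeasure_space_le_1)
    qed (use C not_empty in \<open>auto intro: finite_measure_axioms\<close>)
  qed
  with p st show "\<exists>\<mu>. \<mu> \<in> space M1 \<and>
     (\<forall>f :: real \<Rightarrow> real. continuous_on UNIV f \<and> bounded (range f) \<longrightarrow>
        (\<integral>\<omega>. (\<integral>x. f x \<partial>\<xi> \<omega>) \<partial>M) = (\<integral>x. f x \<partial>\<mu>))"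
    by (intro exI[of _ "M \<bind> \<xi>"]) (auto simp: space_M1)
qed (auto intro!: M1_eqI)

end

theory Submission
  imports Defs
begin

text \<open>
  Write \<open>Y\<^sub>i = X\<^bsub>\<tau> i\<^esub>\<close>. The empirical mean of the \<open>f (Y\<^sub>i)\<close> is the sum of the random mean
  \<open>A\<^sub>n = (1/n) \<Sum>i<n. \<integral> f d\<xi>\<^sub>i\<close> and the deviation
  \<open>(1/n) \<Sum>i<n. (f (Y\<^sub>i) - \<integral> f d\<xi>\<^sub>i)\<close>. Both pieces converge in \<open>L\<^sup>1\<close>, and Markov's inequality
  then gives convergence in probability.

  For the deviation, take first \<open>f\<close> to be the indicator of a Borel set \<open>B\<close>. The summand is then
  the indicator of the event \<open>Y\<^sub>i \<in> B\<close> minus its conditional probability given \<open>\<Xi>\<close>, and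
  conditional independence makes distinct summands orthogonal
  (\<open>integral_centred_indicators_eq_0\<close>). Hence the mean has second moment at most \<open>1/n\<close>
  (\<open>orthogonal_average_tendsto_0_L1\<close>). The deviation is linear in \<open>f\<close> and bounded by twice the
  supremum norm, so the convergence extends from indicators to all bounded Borel functions by
  uniform approximation with simple functions (\<open>deviation_tendsto_0_L1\<close>). In this way
  conditional expectations of indicators suffice throughout.

  For \<open>A\<^sub>n\<close>, the integral of \<open>f\<close> against the averaged measure is the average of the integrals
  (\<open>integral_measure_average\<close>), so the ergodicity assumption says that \<open>A\<^sub>n\<close> converges almost
  surely to the integral of \<open>f\<close> against the barycenter of \<open>\<xi>\<^sub>0\<close>; being bounded, it converges in
  \<open>L\<^sup>1\<close>. The limit is the expectation of \<open>f (X\<^sub>0)\<close>, since the law of \<open>X\<^sub>0\<close> is the mixture of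
  \<open>\<xi>\<^sub>0\<close> (\<open>integral_eq_integral_conditional_law\<close>).
\<close>

section \<open>Averages of bounded and of orthogonal random variables\<close>

lemma abs_mean_le:
  fixes a :: "nat \<Rightarrow> real"
  assumes "\<And>i. i < n \<Longrightarrow> \<bar>a i\<bar> \<le> c" "0 \<le> c"
  shows "\<bar>(1 / real n) * (\<Sum>i<n. a i)\<bar> \<le> c"
proof (cases "n = 0")
  case False
  have "\<bar>\<Sum>i<n. a i\<bar> \<le> real n * c"
    using sum_norm_bound[of "{..<n}" a c] assms(1) by simp
  then show ?thesis using False by (simp add: abs_mult field_simps)
qed (use assms in simp)

lemma (in prob_space) orthogonal_average_tendsto_0_L1:
  fixes Z :: "nat \<Rightarrow> 'a \<Rightarrow> real"
  assumes [measurable]: "\<And>i. Z i \<in> borel_measurable M"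
    and bound: "\<And>i \<omega>. \<omega> \<in> space M \<Longrightarrow> \<bar>Z i \<omega>\<bar> \<le> 1"
    and orth: "\<And>i j. i \<noteq> j \<Longrightarrow> (\<integral>\<omega>. Z i \<omega> * Z j \<omega> \<partial>M) = 0"
  shows "(\<lambda>n. \<integral>\<omega>. \<bar>(1 / real n) * (\<Sum>i<n. Z i \<omega>)\<bar> \<partial>M) \<longlonglongrightarrow> 0"
proof -
  have int_prod: "integrable M (\<lambda>\<omega>. Z i \<omega> * Z j \<omega>)" for i j
  proof (rule integrable_const_bound[where B=1])
    show "AE \<omega> in M. norm (Z i \<omega> * Z j \<omega>) \<le> 1"
      using bound[of _ i] bound[of _ j] by (intro AE_I2) (simp add: abs_mult mult_le_one)
  qed simp
  have square_le: "(\<integral>\<omega>. Z i \<omega> * Z i \<omega> \<partial>M) \<le> 1" for i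
  proof -
    have "(\<integral>\<omega>. Z i \<omega> * Z i \<omega> \<partial>M) \<le> (\<integral>\<omega>. 1 \<partial>M)"
    proof (rule integral_mono[OF int_prod])
      fix \<omega> assume "\<omega> \<in> space M"
      then have "\<bar>Z i \<omega>\<bar> * \<bar>Z i \<omega>\<bar> \<le> 1"
        using bound[of \<omega> i] by (intro mult_le_one) auto
      then show "Z i \<omega> * Z i \<omega> \<le> 1" by simp
    qed simp
    then show ?thesis by (simp add: prob_space)
  qed
  define S where "S n \<omega> = (1 / real n) * (\<Sum>i<n. Z i \<omega>)" for n \<omega>
  have [measurable]: "S n \<in> borel_measurable M" for n
    unfolding S_def by simp
  have S_sq: "(S n \<omega>)\<^sup>2 = (1 / real n)\<^sup>2 * (\<Sum>i<n. \<Sum>j<n. Z i \<omega> * Z j \<omega>)" for n \<omega>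
    unfolding S_def power_mult_distrib
    by (simp only: power2_eq_square[of "sum _ _"] sum_product)
  have int_sq: "integrable M (\<lambda>\<omega>. (S n \<omega>)\<^sup>2)" for n
    unfolding S_sq by (intro integrable_mult_right Bochner_Integration.integrable_sum int_prod)
  have S_sq_le: "(\<integral>\<omega>. (S n \<omega>)\<^sup>2 \<partial>M) \<le> 1 / real n" for n
  proof (cases "n = 0")
    case False
    have "(\<integral>\<omega>. (S n \<omega>)\<^sup>2 \<partial>M) = (1 / real n)\<^sup>2 * (\<Sum>i<n. \<Sum>j<n. \<integral>\<omega>. Z i \<omega> * Z j \<omega> \<partial>M)"
      unfolding S_sq by (simp add: integral_sum int_prod)
    also have "(\<Sum>i<n. \<Sum>j<n. \<integral>\<omega>. Z i \<omega> * Z j \<omega> \<partial>M) =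
        (\<Sum>i<n. \<Sum>j<n. if i = j then \<integral>\<omega>. Z i \<omega> * Z i \<omega> \<partial>M else 0)"
      using orth by (intro sum.cong refl) auto
    also have "\<dots> = (\<Sum>i<n. \<integral>\<omega>. Z i \<omega> * Z i \<omega> \<partial>M)"
      by (intro sum.cong refl) (simp add: sum.delta)
    also have "(1 / real n)\<^sup>2 * \<dots> \<le> (1 / real n)\<^sup>2 * (\<Sum>i<n. 1)"
      by (intro mult_left_mono sum_mono square_le) simp
    also have "\<dots> = 1 / real n"
      using False by (simp add: power2_eq_square)
    finally show ?thesis .
  qed (simp add: S_def)
  \<comment> \<open>Nonnegativity of the variance of \<open>\<bar>S n\<bar>\<close> bounds the \<open>L\<^sup>1\<close> norm by the \<open>L\<^sup>2\<close> norm.\<close>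
  have L1_le: "(\<integral>\<omega>. \<bar>S n \<omega>\<bar> \<partial>M) \<le> sqrt (1 / real n)" for n
  proof -
    have "integrable M (S n)"
      by (rule square_integrable_imp_integrable[OF _ int_sq]) simp
    then have "variance (\<lambda>\<omega>. \<bar>S n \<omega>\<bar>) =
        (\<integral>\<omega>. \<bar>S n \<omega>\<bar>\<^sup>2 \<partial>M) - (\<integral>\<omega>. \<bar>S n \<omega>\<bar> \<partial>M)\<^sup>2"
      using int_sq by (intro variance_eq) auto
    moreover have "0 \<le> variance (\<lambda>\<omega>. \<bar>S n \<omega>\<bar>)"
      by (rule variance_positive)
    ultimately show ?thesis
      using S_sq_le[of n] by (intro real_le_rsqrt) simp
  qed
  have "(\<lambda>n. sqrt (1 / real n)) \<longlonglongrightarrow> sqrt 0"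
    by (intro tendsto_real_sqrt lim_1_over_n)
  then have "(\<lambda>n. sqrt (1 / real n)) \<longlonglongrightarrow> 0" by simp
  then have "(\<lambda>n. \<integral>\<omega>. \<bar>S n \<omega>\<bar> \<partial>M) \<longlonglongrightarrow> 0"
    by (rule tendsto_sandwich[OF _ _ tendsto_const, rotated 2]) (use L1_le in auto)
  then show ?thesis by (simp add: S_def)
qed

section \<open>The deviation of empirical means from random means\<close>

text \<open>A sequence of observations \<open>Y i\<close> together with random laws \<open>\<mu> i\<close> on the same
  probability space. No relation between the two is assumed here.\<close>

locale random_laws = prob_space M for M :: "'a measure" +
  fixes Y :: "nat \<Rightarrow> 'a \<Rightarrow> real" and \<mu> :: "nat \<Rightarrow> 'a \<Rightarrow> real measure"
  assumes Y_measurable [measurable]: "\<And>i. Y i \<in> borel_measurable M"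
    and \<mu>_measurable: "\<And>i. \<mu> i \<in> measurable M (prob_algebra borel)"
begin

text \<open>The mean of the first \<open>n\<close> differences between the observed value of \<open>f\<close> and its
  mean under the random law; it is \<open>0\<close> for \<open>n = 0\<close>.\<close>

definition deviation :: "(real \<Rightarrow> real) \<Rightarrow> nat \<Rightarrow> 'a \<Rightarrow> real" where
  "deviation f n \<omega> = (1 / real n) * (\<Sum>i<n. f (Y i \<omega>) - (\<integral>x. f x \<partial>\<mu> i \<omega>))"

lemma integral_law_measurable [measurable]:
  fixes f :: "real \<Rightarrow> real"
  assumes "f \<in> borel_measurable borel"
  shows "(\<lambda>\<omega>. \<integral>x. f x \<partial>\<mu> i \<omega> :: real) \<in> borel_measurable M"
  by (rule measurable_compose[OF measurable_prob_algebraD[OF \<mu>_measurable]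
        integral_measurable_subprob_algebra[OF assms]])

lemma deviation_measurable [measurable]:
  assumes [measurable]: "f \<in> borel_measurable borel"
  shows "deviation f n \<in> borel_measurable M"
  unfolding deviation_def by measurable

lemma law:
  assumes "\<omega> \<in> space M"
  shows prob_space_law: "prob_space (\<mu> i \<omega>)" and sets_law: "sets (\<mu> i \<omega>) = sets borel"
  using measurable_space[OF \<mu>_measurable assms, of i] by (auto simp: space_prob_algebra)

lemma integrable_law:
  fixes f :: "real \<Rightarrow> real"
  assumes "\<omega> \<in> space M" "f \<in> borel_measurable borel" "\<And>x. \<bar>f x\<bar> \<le> c"
  shows "integrable (\<mu> i \<omega>) f"
proof -
  interpret law: prob_space "\<mu> i \<omega>" by (rule prob_space_law[OF assms(1)])
  show ?thesis
    using assms(2,3) by (intro law.integrable_const_bound[where B=c])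
      (auto simp: measurable_cong_sets[OF sets_law[OF assms(1)] refl])
qed

lemma abs_integral_law_le:
  fixes f :: "real \<Rightarrow> real"
  assumes "\<omega> \<in> space M" "f \<in> borel_measurable borel" "\<And>x. \<bar>f x\<bar> \<le> c"
  shows "\<bar>\<integral>x. f x \<partial>\<mu> i \<omega>\<bar> \<le> c"
proof -
  interpret law: prob_space "\<mu> i \<omega>" by (rule prob_space_law[OF assms(1)])
  have "\<bar>\<integral>x. f x \<partial>\<mu> i \<omega>\<bar> \<le> (\<integral>x. \<bar>f x\<bar> \<partial>\<mu> i \<omega>)"
    using integral_norm_bound[of "\<mu> i \<omega>" f] by simp
  also have "\<dots> \<le> (\<integral>x. c \<partial>\<mu> i \<omega>)"
    by (intro integral_mono integrable_abs integrable_law[OF assms]) (use assms(3) in auto)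
  finally show ?thesis by (simp add: law.prob_space)
qed

lemma abs_deviation_le:
  fixes f :: "real \<Rightarrow> real"
  assumes "\<omega> \<in> space M" "f \<in> borel_measurable borel" "\<And>x. \<bar>f x\<bar> \<le> c"
  shows "\<bar>deviation f n \<omega>\<bar> \<le> 2 * c"
  unfolding deviation_def
proof (rule abs_mean_le)
  show "\<bar>f (Y i \<omega>) - (\<integral>x. f x \<partial>\<mu> i \<omega>)\<bar> \<le> 2 * c" for i
    using assms(3)[of "Y i \<omega>"] abs_integral_law_le[OF assms, of i] by linarith
  show "0 \<le> 2 * c" using assms(3)[of 0] by linarith
qed

lemma integrable_deviation:
  assumes "f \<in> borel_measurable borel" "\<And>x. \<bar>f x\<bar> \<le> c"
  shows "integrable M (deviation f n)"
  by (rule integrable_const_bound[where B="2 * c"])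
    (use abs_deviation_le[OF _ assms] deviation_measurable[OF assms(1)] in auto)

lemma deviation_simple_plus:
  assumes w: "\<omega> \<in> space M" and r: "r \<in> borel_measurable borel" "\<And>x. \<bar>r x\<bar> \<le> c"
    and A: "\<And>k. A k \<in> sets borel"
  shows "deviation (\<lambda>x. r x + (\<Sum>k\<in>K. a k * indicator (A k) x)) n \<omega> =
    deviation r n \<omega> + (\<Sum>k\<in>K. a k * deviation (indicator (A k)) n \<omega>)"
proof -
  have int_ind: "integrable (\<mu> i \<omega>) (indicator (A k) :: real \<Rightarrow> real)" for i k
    by (rule integrable_law[OF w, where c=1]) (use A in \<open>auto simp: indicator_def\<close>)
  have int_sum: "(\<integral>x. r x + (\<Sum>k\<in>K. a k * indicator (A k) x) \<partial>\<mu> i \<omega>) =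
      (\<integral>x. r x \<partial>\<mu> i \<omega>) + (\<Sum>k\<in>K. a k * (\<integral>x. indicator (A k) x \<partial>\<mu> i \<omega>))" for i
    by (subst Bochner_Integration.integral_add)
      (auto intro!: integrable_law[OF w r] Bochner_Integration.integrable_sum integrable_mult_right int_ind
        simp: Bochner_Integration.integral_sum int_ind simp del: integral_indicator)
  have "(\<Sum>i<n. r (Y i \<omega>) + (\<Sum>k\<in>K. a k * indicator (A k) (Y i \<omega>)) -
        ((\<integral>x. r x \<partial>\<mu> i \<omega>) + (\<Sum>k\<in>K. a k * (\<integral>x. indicator (A k) x \<partial>\<mu> i \<omega>)))) =
      (\<Sum>i<n. (r (Y i \<omega>) - (\<integral>x. r x \<partial>\<mu> i \<omega>)) +
        (\<Sum>k\<in>K. a k * (indicator (A k) (Y i \<omega>) - (\<integral>x. indicator (A k) x \<partial>\<mu> i \<omega>))))"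
    by (intro sum.cong refl) (simp add: right_diff_distrib sum_subtractf del: integral_indicator)
  also have "\<dots> = (\<Sum>i<n. r (Y i \<omega>) - (\<integral>x. r x \<partial>\<mu> i \<omega>)) + (\<Sum>k\<in>K. a k *
        (\<Sum>i<n. indicator (A k) (Y i \<omega>) - (\<integral>x. indicator (A k) x \<partial>\<mu> i \<omega>)))"
    unfolding sum.distrib sum_distrib_left by (subst (2) sum.swap) simp
  finally show ?thesis
    unfolding deviation_def int_sum
    by (simp add: distrib_left sum_distrib_left mult.left_commute del: integral_indicator)
qed

text \<open>Convergence of the deviation passes from indicators to linear combinations and, as
  \<open>\<bar>deviation r n\<bar> \<le> 2 sup \<bar>r\<bar>\<close> uniformly in \<open>n\<close>, to uniform limits, hence to all bounded
  Borel functions.\<close>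

lemma deviation_tendsto_0_L1:
  fixes f :: "real \<Rightarrow> real"
  assumes ind: "\<And>A. A \<in> sets borel \<Longrightarrow>
      (\<lambda>n. \<integral>\<omega>. \<bar>deviation (indicator A) n \<omega>\<bar> \<partial>M) \<longlonglongrightarrow> 0"
    and f [measurable]: "f \<in> borel_measurable borel" and C: "\<And>x. \<bar>f x\<bar> \<le> C"
  shows "(\<lambda>n. \<integral>\<omega>. \<bar>deviation f n \<omega>\<bar> \<partial>M) \<longlonglongrightarrow> 0"
proof (rule LIMSEQ_I)
  fix \<epsilon> :: real assume "0 < \<epsilon>"
  define \<delta> where "\<delta> = \<epsilon> / 4"
  have \<delta>: "0 < \<delta>" "2 * \<delta> < \<epsilon>" using \<open>0 < \<epsilon>\<close> by (auto simp: \<delta>_def)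
  \<comment> \<open>Round \<open>f\<close> down to a multiple of \<open>\<delta>\<close>; boundedness leaves finitely many levels.\<close>
  define A where "A k = {x. \<lfloor>f x / \<delta>\<rfloor> = k}" for k :: int
  define K where "K = {\<lfloor>- C / \<delta>\<rfloor>..\<lfloor>C / \<delta>\<rfloor>}"
  define r where "r x = f x - of_int \<lfloor>f x / \<delta>\<rfloor> * \<delta>" for x
  have A: "A k \<in> sets borel" for k
    unfolding A_def by measurable
  have r_meas: "r \<in> borel_measurable borel"
    unfolding r_def by measurable
  have r_le: "\<bar>r x\<bar> \<le> \<delta>" for x
  proof -
    have "of_int \<lfloor>f x / \<delta>\<rfloor> * \<delta> \<le> f x" "f x < (of_int \<lfloor>f x / \<delta>\<rfloor> + 1) * \<delta>"
      unfolding pos_le_divide_eq[OF \<delta>(1), symmetric] pos_divide_less_eq[OF \<delta>(1), symmetric]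
      by linarith+
    then show ?thesis by (simp add: r_def abs_le_iff algebra_simps)
  qed
  have f_eq: "f = (\<lambda>x. r x + (\<Sum>k\<in>K. (of_int k * \<delta>) * indicator (A k) x))"
  proof
    fix x
    have "\<lfloor>f x / \<delta>\<rfloor> \<in> K"
      using C[of x] \<delta>(1) unfolding K_def
      by (auto intro!: floor_mono simp: divide_le_cancel abs_le_iff field_simps)
    then have "(\<Sum>k\<in>K. (of_int k * \<delta>) * indicator (A k) x) = of_int \<lfloor>f x / \<delta>\<rfloor> * \<delta>"
      by (subst sum.remove[of K "\<lfloor>f x / \<delta>\<rfloor>"]) (auto simp: K_def A_def intro!: sum.neutral)
    then show "f x = r x + (\<Sum>k\<in>K. (of_int k * \<delta>) * indicator (A k) x)"
      by (simp add: r_def)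
  qed
  let ?D = "\<lambda>k n. \<integral>\<omega>. \<bar>deviation (indicator (A k)) n \<omega>\<bar> \<partial>M"
  have int_ind: "integrable M (deviation (indicator (A k)) n)" for k n
    by (rule integrable_deviation[where c=1]) (use A in \<open>auto simp: indicator_def\<close>)
  have le: "(\<integral>\<omega>. \<bar>deviation f n \<omega>\<bar> \<partial>M) \<le> 2 * \<delta> + (\<Sum>k\<in>K. \<bar>of_int k * \<delta>\<bar> * ?D k n)" for n
  proof -
    have "(\<integral>\<omega>. \<bar>deviation f n \<omega>\<bar> \<partial>M) \<le>
        (\<integral>\<omega>. 2 * \<delta> + (\<Sum>k\<in>K. \<bar>of_int k * \<delta>\<bar> * \<bar>deviation (indicator (A k)) n \<omega>\<bar>) \<partial>M)"
    proof (rule integral_mono)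
      fix \<omega> assume w: "\<omega> \<in> space M"
      have "\<bar>deviation f n \<omega>\<bar> \<le> \<bar>deviation r n \<omega>\<bar> +
          \<bar>\<Sum>k\<in>K. (of_int k * \<delta>) * deviation (indicator (A k)) n \<omega>\<bar>"
        by (subst f_eq, subst deviation_simple_plus[OF w r_meas r_le A]) (rule abs_triangle_ineq)
      also have "\<dots> \<le> 2 * \<delta> + (\<Sum>k\<in>K. \<bar>of_int k * \<delta>\<bar> * \<bar>deviation (indicator (A k)) n \<omega>\<bar>)"
        by (intro add_mono abs_deviation_le[OF w r_meas r_le] order.trans[OF sum_abs] sum_mono)
          (simp add: abs_mult)
      finally show "\<bar>deviation f n \<omega>\<bar> \<le> \<dots>" .
    qed (auto intro!: integrable_abs integrable_deviation[OF f C] Bochner_Integration.integrable_sum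
        integrable_mult_right int_ind Bochner_Integration.integrable_add)
    also have "\<dots> = 2 * \<delta> + (\<Sum>k\<in>K. \<bar>of_int k * \<delta>\<bar> * ?D k n)"
      by (subst Bochner_Integration.integral_add)
        (auto simp: Bochner_Integration.integral_sum int_ind prob_space
          intro!: Bochner_Integration.integrable_sum integrable_mult_right integrable_abs int_ind)
    finally show ?thesis .
  qed
  have "(\<lambda>n. 2 * \<delta> + (\<Sum>k\<in>K. \<bar>of_int k * \<delta>\<bar> * ?D k n)) \<longlonglongrightarrow>
      2 * \<delta> + (\<Sum>k\<in>K. \<bar>of_int k * \<delta>\<bar> * 0)"
    by (intro tendsto_intros ind A)
  then have "\<forall>\<^sub>F n in sequentially. 2 * \<delta> + (\<Sum>k\<in>K. \<bar>of_int k * \<delta>\<bar> * ?D k n) < \<epsilon>"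
    using \<delta>(2) by (intro order_tendstoD) auto
  then have "\<forall>\<^sub>F n in sequentially. norm ((\<integral>\<omega>. \<bar>deviation f n \<omega>\<bar> \<partial>M) - 0) < \<epsilon>"
    by eventually_elim (use le in \<open>auto intro: le_less_trans\<close>)
  then show "\<exists>N. \<forall>n\<ge>N. norm ((\<integral>\<omega>. \<bar>deviation f n \<omega>\<bar> \<partial>M) - 0) < \<epsilon>"
    by (simp add: eventually_sequentially)
qed

end

section \<open>Conditional independence and orthogonality\<close>

text \<open>Centring two conditionally independent events at their conditional probabilities makes
  them orthogonal in \<open>L\<^sup>2\<close>.\<close>

lemma (in finite_measure_subalgebra) integral_centred_indicators_eq_0:
  fixes p q :: "'a \<Rightarrow> real"
  assumes A: "A \<in> sets M" and B: "B \<in> sets M"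
    and p: "p \<in> borel_measurable F" "\<And>\<omega>. \<omega> \<in> space M \<Longrightarrow> \<bar>p \<omega>\<bar> \<le> 1"
    and q: "q \<in> borel_measurable F" "\<And>\<omega>. \<omega> \<in> space M \<Longrightarrow> \<bar>q \<omega>\<bar> \<le> 1"
    and condA: "AE \<omega> in M. cond_prob_given M F A \<omega> = p \<omega>"
    and condB: "AE \<omega> in M. cond_prob_given M F B \<omega> = q \<omega>"
    and condAB: "AE \<omega> in M. cond_prob_given M F (A \<inter> B) \<omega> = p \<omega> * q \<omega>"
  shows "(\<integral>\<omega>. (indicator A \<omega> - p \<omega>) * (indicator B \<omega> - q \<omega>) \<partial>M) = 0"
proof -
  note [measurable] = A B measurable_from_subalg[OF subalg p(1)] measurable_from_subalg[OF subalg q(1)]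
  have int: "integrable M h" if "h \<in> borel_measurable M" "\<And>\<omega>. \<omega> \<in> space M \<Longrightarrow> \<bar>h \<omega>\<bar> \<le> 1"
    for h :: "'a \<Rightarrow> real"
    using that by (intro integrable_const_bound[where B=1]) auto
  have i: "integrable M (\<lambda>\<omega>. indicator A \<omega> * indicator B \<omega> :: real)"
      "integrable M (\<lambda>\<omega>. p \<omega> * indicator B \<omega>)"
      "integrable M (\<lambda>\<omega>. q \<omega> * indicator A \<omega>)"
      "integrable M (\<lambda>\<omega>. p \<omega> * q \<omega>)"
    by (intro int; use p(2) q(2) in \<open>auto simp: abs_mult mult_le_one indicator_def\<close>)+
  have "(\<integral>\<omega>. indicator A \<omega> * indicator B \<omega> \<partial>M) = (\<integral>\<omega>. cond_prob_given M F (A \<inter> B) \<omega> \<partial>M)"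
    using real_cond_exp_int(2)[of "indicator (A \<inter> B)"] i(1)
    unfolding cond_prob_given_def indicator_inter_arith by simp
  also have "\<dots> = (\<integral>\<omega>. p \<omega> * q \<omega> \<partial>M)"
    using condAB by (intro integral_cong_AE) (auto simp: cond_prob_given_def)
  finally have 1: "(\<integral>\<omega>. indicator A \<omega> * indicator B \<omega> \<partial>M) = (\<integral>\<omega>. p \<omega> * q \<omega> \<partial>M)" .
  have "(\<integral>\<omega>. p \<omega> * indicator B \<omega> \<partial>M) = (\<integral>\<omega>. p \<omega> * cond_prob_given M F B \<omega> \<partial>M)"
    unfolding cond_prob_given_def by (rule real_cond_exp_intg(2)[OF i(2) p(1), symmetric]) simp
  also have "\<dots> = (\<integral>\<omega>. p \<omega> * q \<omega> \<partial>M)"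
    using condB by (intro integral_cong_AE) (auto simp: cond_prob_given_def)
  finally have 2: "(\<integral>\<omega>. p \<omega> * indicator B \<omega> \<partial>M) = (\<integral>\<omega>. p \<omega> * q \<omega> \<partial>M)" .
  have "(\<integral>\<omega>. q \<omega> * indicator A \<omega> \<partial>M) = (\<integral>\<omega>. q \<omega> * cond_prob_given M F A \<omega> \<partial>M)"
    unfolding cond_prob_given_def by (rule real_cond_exp_intg(2)[OF i(3) q(1), symmetric]) simp
  also have "\<dots> = (\<integral>\<omega>. p \<omega> * q \<omega> \<partial>M)"
    using condA by (intro integral_cong_AE) (auto simp: cond_prob_given_def mult.commute)
  finally have 3: "(\<integral>\<omega>. q \<omega> * indicator A \<omega> \<partial>M) = (\<integral>\<omega>. p \<omega> * q \<omega> \<partial>M)" .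
  have "(\<integral>\<omega>. (indicator A \<omega> - p \<omega>) * (indicator B \<omega> - q \<omega>) \<partial>M) =
      (\<integral>\<omega>. indicator A \<omega> * indicator B \<omega> - p \<omega> * indicator B \<omega> -
        q \<omega> * indicator A \<omega> + p \<omega> * q \<omega> \<partial>M)"
    by (simp add: algebra_simps)
  also have "\<dots> = (\<integral>\<omega>. indicator A \<omega> * indicator B \<omega> \<partial>M) - (\<integral>\<omega>. p \<omega> * indicator B \<omega> \<partial>M) -
      (\<integral>\<omega>. q \<omega> * indicator A \<omega> \<partial>M) + (\<integral>\<omega>. p \<omega> * q \<omega> \<partial>M)"
    using i by (simp del: integral_indicator)
  finally show ?thesis unfolding 1 2 3 by simp
qed

lemma sets_generated_algebra:
  "sets (generated_algebra \<Omega> I N Y) = sigma_sets \<Omega> (\<Union>i\<in>I. {Y i -` A \<inter> \<Omega> | A. A \<in> sets N})"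
  unfolding generated_algebra_def by (rule sets_measure_of) auto

lemma space_generated_algebra [simp]: "space (generated_algebra \<Omega> I N Y) = \<Omega>"
  unfolding generated_algebra_def by (simp add: space_measure_of_conv)

lemma vimage_in_generated_algebra:
  assumes "i \<in> I" "A \<in> sets N"
  shows "Y i -` A \<inter> \<Omega> \<in> sets (generated_algebra \<Omega> I N Y)"
  unfolding sets_generated_algebra using assms by (intro sigma_sets.Basic) blast

lemma subalgebra_generated_algebra:
  assumes "\<And>i. i \<in> I \<Longrightarrow> Y i \<in> measurable M N"
  shows "subalgebra M (generated_algebra (space M) I N Y)"
proof -
  have "sigma_sets (space M) (\<Union>i\<in>I. {Y i -` A \<inter> space M | A. A \<in> sets N}) \<subseteq> sets M"
    using assms by (intro sets.sigma_sets_subset) (auto intro: measurable_sets)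
  then show ?thesis by (simp add: subalgebra_def sets_generated_algebra)
qed

lemma measurable_generated_algebra:
  assumes "i \<in> I" "Y i \<in> measurable M N"
  shows "Y i \<in> measurable (generated_algebra (space M) I N Y) N"
  using assms measurable_space[OF assms(2)]
  by (intro measurableI) (auto intro: vimage_in_generated_algebra)

lemma cond_indep_setsD:
  assumes "cond_indep_sets M G F I" "i \<in> I" "j \<in> I" "i \<noteq> j" "A \<in> F i" "B \<in> F j"
  shows "AE \<omega> in M. cond_prob_given M G (A \<inter> B) \<omega> = cond_prob_given M G A \<omega> * cond_prob_given M G B \<omega>"
proof -
  have "AE \<omega> in M. cond_prob_given M G (\<Inter>k\<in>{i, j}. if k = i then A else B) \<omega> =
      (\<Prod>k\<in>{i, j}. cond_prob_given M G (if k = i then A else B) \<omega>)"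
    using assms unfolding cond_indep_sets_def
    by (intro assms(1)[unfolded cond_indep_sets_def, THEN conjunct2, rule_format]) auto
  then show ?thesis using assms(4) by (simp add: Int_commute)
qed

section \<open>Integrals against averages and mixtures of laws\<close>

lemma integral_measure_average:
  fixes f :: "real \<Rightarrow> real"
  assumes n: "0 < n" and \<nu>: "\<And>t. \<nu> t \<in> space M1"
    and f: "f \<in> borel_measurable borel" "\<And>x. \<bar>f x\<bar> \<le> C"
  shows "(\<integral>x. f x \<partial>measure_average n \<nu>) = (1 / real n) * (\<Sum>t<n. \<integral>x. f x \<partial>\<nu> t)"
proof -
  define U where "U = pmf_of_set {..<n}"
  have fin: "finite {..<n}" "{..<n} \<noteq> {}" using n by auto
  have \<nu>': "prob_space (\<nu> t)" "sets (\<nu> t) = sets borel" for t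
    using \<nu>[of t] by (auto simp: space_M1)
  have kernel: "\<nu> \<in> measurable (measure_pmf U) (subprob_algebra borel)"
    using \<nu>' by (simp add: space_subprob_algebra prob_space_imp_subprob_space)
  \<comment> \<open>The average is the mixture of the \<open>\<nu> t\<close> over a uniformly distributed index.\<close>
  have "measure_average n \<nu> = measure_pmf U \<bind> \<nu>"
  proof (rule measure_eqI)
    show "sets (measure_average n \<nu>) = sets (measure_pmf U \<bind> \<nu>)"
      using sets_bind_measurable[OF kernel] by simp
    fix B assume "B \<in> sets (measure_average n \<nu>)"
    then have B: "B \<in> sets borel" by simp
    have "emeasure (measure_pmf U \<bind> \<nu>) B = (\<integral>\<^sup>+t. emeasure (\<nu> t) B \<partial>measure_pmf U)"
      by (rule emeasure_bind[OF _ kernel B]) simp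
    also have "\<dots> = (\<Sum>t<n. emeasure (\<nu> t) B) / of_nat n"
      unfolding U_def using fin by (simp add: nn_integral_pmf_of_set)
    finally show "emeasure (measure_average n \<nu>) B = emeasure (measure_pmf U \<bind> \<nu>) B"
      using emeasure_measure_average[of n \<nu> B] \<nu>'(2) B by simp
  qed
  moreover have "(\<integral>x. f x \<partial>(measure_pmf U \<bind> \<nu>)) = (\<integral>t. (\<integral>x. f x \<partial>\<nu> t) \<partial>measure_pmf U)"
    using \<nu>' f(2)
    by (intro integral_bind[OF f(1) _ kernel, of C 1])
      (auto simp: subprob_space.emeasure_space_le_1 prob_space_imp_subprob_space
        intro: measure_pmf.finite_measure_axioms)
  moreover have "(\<integral>t. (\<integral>x. f x \<partial>\<nu> t) \<partial>measure_pmf U) = (1 / real n) * (\<Sum>t<n. \<integral>x. f x \<partial>\<nu> t)"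
    unfolding U_def using fin by (simp add: integral_pmf_of_set)
  ultimately show ?thesis by simp
qed

text \<open>If the probabilities of \<open>Y\<close> are the means of those under the random law \<open>\<mu>\<close>, the
  distribution of \<open>Y\<close> is the mixture \<open>M \<bind> \<mu>\<close>, and this determines expectations.\<close>

lemma (in prob_space) integral_eq_integral_conditional_law:
  fixes f :: "real \<Rightarrow> real"
  assumes [measurable]: "Y \<in> borel_measurable M" and kernel: "\<mu> \<in> measurable M (prob_algebra borel)"
    and law: "\<And>B. B \<in> sets borel \<Longrightarrow> prob (Y -` B \<inter> space M) = (\<integral>\<omega>. measure (\<mu> \<omega>) B \<partial>M)"
    and f: "f \<in> borel_measurable borel" "\<And>x. \<bar>f x\<bar> \<le> C"
  shows "(\<integral>\<omega>. f (Y \<omega>) \<partial>M) = (\<integral>\<omega>. (\<integral>x. f x \<partial>\<mu> \<omega>) \<partial>M)"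
proof -
  note kernel' = measurable_prob_algebraD[OF kernel]
  have \<mu>: "prob_space (\<mu> \<omega>)" "sets (\<mu> \<omega>) = sets borel" if "\<omega> \<in> space M" for \<omega>
    using measurable_space[OF kernel that] by (auto simp: space_prob_algebra)
  have "distr M borel Y = M \<bind> \<mu>"
  proof (rule measure_eqI)
    show "sets (distr M borel Y) = sets (M \<bind> \<mu>)"
      using sets_bind_measurable[OF kernel' not_empty] by simp
    fix B assume "B \<in> sets (distr M borel Y)"
    then have B: "B \<in> sets borel" by simp
    have m: "(\<lambda>\<omega>. measure (\<mu> \<omega>) B) \<in> borel_measurable M"
      using measurable_compose[OF kernel' measurable_measure_subprob_algebra[OF B]] .
    have "emeasure (M \<bind> \<mu>) B = (\<integral>\<^sup>+\<omega>. emeasure (\<mu> \<omega>) B \<partial>M)"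
      by (rule emeasure_bind[OF not_empty kernel' B])
    also have "\<dots> = (\<integral>\<^sup>+\<omega>. ennreal (measure (\<mu> \<omega>) B) \<partial>M)"
      using \<mu> by (intro nn_integral_cong)
        (auto simp: finite_measure.emeasure_eq_measure prob_space.finite_measure)
    also have "\<dots> = ennreal (\<integral>\<omega>. measure (\<mu> \<omega>) B \<partial>M)"
      using \<mu> m by (intro nn_integral_eq_integral integrable_const_bound[where B=1])
        (auto simp: prob_space.prob_le_1)
    also have "\<dots> = emeasure (distr M borel Y) B"
      using B by (simp add: emeasure_distr law[symmetric] emeasure_eq_measure)
    finally show "emeasure (distr M borel Y) B = emeasure (M \<bind> \<mu>) B" by simp
  qed
  moreover have "(\<integral>x. f x \<partial>(M \<bind> \<mu>)) = (\<integral>\<omega>. (\<integral>x. f x \<partial>\<mu> \<omega>) \<partial>M)"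
    using \<mu> f(2) not_empty
    by (intro integral_bind[OF f(1) _ kernel', of C 1])
      (auto simp: subprob_space.emeasure_space_le_1 prob_space_imp_subprob_space
        intro: finite_measure_axioms)
  moreover have "(\<integral>\<omega>. f (Y \<omega>) \<partial>M) = (\<integral>x. f x \<partial>distr M borel Y)"
    using f(1) by (simp add: integral_distr)
  ultimately show ?thesis by simp
qed

section \<open>Convergence in probability\<close>

lemma (in prob_space) converges_in_probability_L1:
  assumes "\<And>n. integrable M (\<lambda>\<omega>. Y n \<omega> - Z \<omega>)"
    and L1: "(\<lambda>n. \<integral>\<omega>. \<bar>Y n \<omega> - Z \<omega>\<bar> \<partial>M) \<longlonglongrightarrow> 0"
  shows "converges_in_probability M Y Z"
  unfolding converges_in_probability_def
proof (intro allI impI)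
  fix \<epsilon> :: real assume \<epsilon>: "0 < \<epsilon>"
  have Markov: "measure M {\<omega> \<in> space M. \<bar>Y n \<omega> - Z \<omega>\<bar> > \<epsilon>} \<le> (\<integral>\<omega>. \<bar>Y n \<omega> - Z \<omega>\<bar> \<partial>M) / \<epsilon>" for n
  proof -
    note [measurable] = borel_measurable_integrable[OF assms(1)]
    have "measure M {\<omega> \<in> space M. \<bar>Y n \<omega> - Z \<omega>\<bar> > \<epsilon>} \<le> measure M {\<omega> \<in> space M. \<bar>Y n \<omega> - Z \<omega>\<bar> \<ge> \<epsilon>}"
      by (intro finite_measure_mono) auto
    also have "\<dots> \<le> (\<integral>\<omega>. \<bar>Y n \<omega> - Z \<omega>\<bar> \<partial>M) / \<epsilon>"
      using \<epsilon> by (intro integral_Markov_inequality_measure[where A="space M"] integrable_abs assms) auto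
    finally show ?thesis .
  qed
  have "(\<lambda>n. (\<integral>\<omega>. \<bar>Y n \<omega> - Z \<omega>\<bar> \<partial>M) / \<epsilon>) \<longlonglongrightarrow> 0"
    using tendsto_divide[OF L1 tendsto_const[of \<epsilon>]] \<epsilon> by simp
  then show "(\<lambda>n. measure M {\<omega> \<in> space M. \<bar>Y n \<omega> - Z \<omega>\<bar> > \<epsilon>}) \<longlonglongrightarrow> 0"
    by (rule tendsto_sandwich[OF _ _ tendsto_const, rotated 2]) (use Markov in auto)
qed

section \<open>The law of large numbers along a cyclic-independent conjugate process\<close>

theorem theorem1:
  fixes M :: "'a measure"
    and \<xi> :: "nat \<Rightarrow> 'a \<Rightarrow> real measure"
    and X :: "real \<Rightarrow> 'a \<Rightarrow> real"
    and \<tau> :: "nat \<Rightarrow> real"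
    and f :: "real \<Rightarrow> real"
  assumes "prob_space M"
    and "stationary_sequence M M1 \<xi>"
    and "conjugate_process M \<xi> X"
    and "cyclic_independent M \<xi> X"
    and "ergodic_measures M \<xi>"
    and "\<And>i. \<tau> i \<in> {real i..<real i + 1}"
    and "continuous_on UNIV f" and "bounded (range f)"
  shows "converges_in_probability M
           (\<lambda>n \<omega>. (1 / real n) * (\<Sum>i<n. f (X (\<tau> i) \<omega>)))
           (\<lambda>_. \<integral>\<omega>. f (X 0 \<omega>) \<partial>M)"
proof -
  define G where "G = generated_algebra (space M) UNIV M1 \<xi>"
  define Y where "Y i = X (\<tau> i)" for i
  define c where "c = (\<integral>\<omega>. f (X 0 \<omega>) \<partial>M)"
  interpret prob_space M by fact
  have \<xi>: "\<xi> t \<in> measurable M M1" for t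
    using assms(2) by (simp add: stationary_sequence_def)
  have \<xi>_G: "\<xi> t \<in> measurable G M1" for t
    unfolding G_def by (rule measurable_generated_algebra[OF UNIV_I \<xi>])
  interpret finite_measure_subalgebra M G
    by unfold_locales (unfold G_def, rule subalgebra_generated_algebra[OF \<xi>])
  have X: "X s \<in> borel_measurable M" if "0 \<le> s" for s
    using assms(3) that by (simp add: conjugate_process_def)
  have \<tau>_nonneg: "0 \<le> \<tau> i" for i
    using assms(6)[of i] by auto
  interpret random_laws M Y \<xi>
    by unfold_locales (auto simp: Y_def X \<tau>_nonneg intro: measurable_prob_algebra_of_M1 \<xi>)
  have f: "f \<in> borel_measurable borel"
    by (rule borel_measurable_continuous_onI) fact
  obtain C where C: "\<bar>f x\<bar> \<le> C" for x
    using assms(8) by (auto simp: bounded_iff)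

  \<comment> \<open>Each \<open>\<xi> t\<close> is measurable with respect to the conditioning algebra \<open>G\<close>, so its values on
    Borel sets may serve as factors inside conditional expectations.\<close>
  have prob_G: "(\<lambda>\<omega>. measure (\<xi> t \<omega>) B) \<in> borel_measurable G" if "B \<in> sets borel" for t B
    by (rule measurable_compose[OF measurable_prob_algebraD[OF measurable_prob_algebra_of_M1[OF \<xi>_G]]
          measurable_measure_subprob_algebra[OF that]])
  have prob_bound: "\<bar>measure (\<xi> t \<omega>) B\<bar> \<le> 1" if "\<omega> \<in> space M" for t \<omega> B
    using prob_space.prob_le_1[OF prob_space_law[OF that]] by simp
  have cond: "AE \<omega> in M. cond_prob_given M G (X s -` B \<inter> space M) \<omega> = measure (\<xi> t \<omega>) B"
    if "B \<in> sets borel" "s \<in> {real t..<real t + 1}" for B s t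
    using assms(3) that unfolding conjugate_process_def G_def by blast

  have "(\<lambda>n. \<integral>\<omega>. \<bar>deviation (indicator B) n \<omega>\<bar> \<partial>M) \<longlonglongrightarrow> 0" if B: "B \<in> sets borel" for B
  proof -
    define E where "E i = Y i -` B \<inter> space M" for i
    define Z where "Z i \<omega> = indicator B (Y i \<omega>) - measure (\<xi> i \<omega>) B" for i \<omega>
    have E: "E i \<in> sets M" for i
      unfolding E_def using B by simp
    have Z_E: "Z i \<omega> = indicator (E i) \<omega> - measure (\<xi> i \<omega>) B" if "\<omega> \<in> space M" for i \<omega>
      using that by (simp add: Z_def E_def indicator_def)
    have condE: "AE \<omega> in M. cond_prob_given M G (E i) \<omega> = measure (\<xi> i \<omega>) B" for i
      unfolding E_def Y_def by (rule cond[OF B assms(6)])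
    have "(\<integral>\<omega>. Z i \<omega> * Z j \<omega> \<partial>M) = 0" if "i \<noteq> j" for i j
    proof -
      have E_block: "E k \<in> sets (generated_algebra (space M) {real k..<real k + 1} borel X)" for k
        unfolding E_def Y_def by (rule vimage_in_generated_algebra[OF assms(6) B])
      have "AE \<omega> in M. cond_prob_given M G (E i \<inter> E j) \<omega> =
          cond_prob_given M G (E i) \<omega> * cond_prob_given M G (E j) \<omega>"
        using assms(4) unfolding cyclic_independent_def G_def[symmetric]
        by (rule cond_indep_setsD[OF _ UNIV_I UNIV_I that E_block E_block])
      with condE[of i] condE[of j]
      have "AE \<omega> in M. cond_prob_given M G (E i \<inter> E j) \<omega> = measure (\<xi> i \<omega>) B * measure (\<xi> j \<omega>) B"
        by eventually_elim simp
      then have "(\<integral>\<omega>. (indicator (E i) \<omega> - measure (\<xi> i \<omega>) B) *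
          (indicator (E j) \<omega> - measure (\<xi> j \<omega>) B) \<partial>M) = 0"
        by (intro integral_centred_indicators_eq_0 E prob_G prob_bound B condE)
      then show ?thesis
        by (simp add: Z_E cong: Bochner_Integration.integral_cong)
    qed
    moreover have "Z i \<in> borel_measurable M" for i
      unfolding Z_def using B measurable_from_subalg[OF subalg prob_G[OF B]] by measurable
    moreover have "\<bar>Z i \<omega>\<bar> \<le> 1" if "\<omega> \<in> space M" for i \<omega>
      using prob_bound[OF that, of i B] measure_nonneg[of "\<xi> i \<omega>" B]
      by (auto simp: Z_def indicator_def)
    ultimately have "(\<lambda>n. \<integral>\<omega>. \<bar>(1 / real n) * (\<Sum>i<n. Z i \<omega>)\<bar> \<partial>M) \<longlonglongrightarrow> 0"
      by (intro orthogonal_average_tendsto_0_L1)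
    moreover have "deviation (indicator B) n \<omega> = (1 / real n) * (\<Sum>i<n. Z i \<omega>)"
      if "\<omega> \<in> space M" for n \<omega>
      using sets_law[OF that] sets_eq_imp_space_eq[OF sets_law[OF that]] by (simp add: deviation_def Z_def)
    ultimately show ?thesis
      by (simp cong: Bochner_Integration.integral_cong)
  qed
  then have dev: "(\<lambda>n. \<integral>\<omega>. \<bar>deviation f n \<omega>\<bar> \<partial>M) \<longlonglongrightarrow> 0"
    by (rule deviation_tendsto_0_L1[OF _ f C])

  have "(\<integral>\<omega>. f (X 0 \<omega>) \<partial>M) = (\<integral>\<omega>. (\<integral>x. f x \<partial>\<xi> 0 \<omega>) \<partial>M)"
  proof (rule integral_eq_integral_conditional_law[OF X _ _ f C])
    show "\<xi> 0 \<in> measurable M (prob_algebra borel)"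
      by (rule measurable_prob_algebra_of_M1[OF \<xi>])
    fix B :: "real set" assume B: "B \<in> sets borel"
    have X0: "X 0 -` B \<inter> space M \<in> sets M"
      using X[of 0] B by (intro measurable_sets) auto
    have "prob (X 0 -` B \<inter> space M) = (\<integral>\<omega>. cond_prob_given M G (X 0 -` B \<inter> space M) \<omega> \<partial>M)"
      using real_cond_exp_int(2)[OF integrable_real_indicator[OF X0]]
      by (simp add: cond_prob_given_def emeasure_eq_measure)
    also have "\<dots> = (\<integral>\<omega>. measure (\<xi> 0 \<omega>) B \<partial>M)"
      using cond[OF B, of 0 0] measurable_from_subalg[OF subalg prob_G[OF B]]
      by (intro integral_cong_AE) (auto simp: cond_prob_given_def)
    finally show "prob (X 0 -` B \<inter> space M) = (\<integral>\<omega>. measure (\<xi> 0 \<omega>) B \<partial>M)" .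
  qed simp
  moreover have bary: "barycenter M (\<xi> 0) \<in> space M1"
    and "(\<integral>\<omega>. (\<integral>x. f x \<partial>\<xi> 0 \<omega>) \<partial>M) = (\<integral>x. f x \<partial>barycenter M (\<xi> 0))"
    using theI'[OF barycenter_exists_unique[OF assms(1) \<xi>[of 0]]] assms(7,8)
    unfolding barycenter_def by blast+
  ultimately have c_bary: "c = (\<integral>x. f x \<partial>barycenter M (\<xi> 0))"
    by (simp add: c_def)

  define A where "A n \<omega> = (1 / real n) * (\<Sum>i<n. \<integral>x. f x \<partial>\<xi> i \<omega>)" for n \<omega>
  have [measurable]: "A n \<in> borel_measurable M" for n
    unfolding A_def using f by measurable
  have C_nonneg: "0 \<le> C" using C[of 0] by linarith
  have A_le: "\<bar>A n \<omega>\<bar> \<le> C" if "\<omega> \<in> space M" for n \<omega>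
    unfolding A_def by (rule abs_mean_le[OF abs_integral_law_le[OF that f C] C_nonneg])
  have A_lim: "AE \<omega> in M. (\<lambda>n. A n \<omega>) \<longlonglongrightarrow> c"
    using assms(5) AE_space unfolding ergodic_measures_def
  proof eventually_elim
    fix \<omega> assume L: "limitin weak_topology (\<lambda>n. measure_average n (\<lambda>t. \<xi> t \<omega>))
        (barycenter M (\<xi> 0)) sequentially" and \<omega>: "\<omega> \<in> space M"
    have M1: "\<xi> t \<omega> \<in> space M1" for t
      by (rule measurable_space[OF \<xi> \<omega>])
    \<comment> \<open>The average of \<open>0\<close> measures is not a probability measure, whence \<open>0 < n\<close>.\<close>
    have "\<forall>\<^sub>F n in sequentially. measure_average n (\<lambda>t. \<xi> t \<omega>) \<in> space M1"
      using eventually_gt_at_top[of 0] by eventually_elim (rule measure_average_in_M1[OF _ M1])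
    then have "(\<lambda>n. \<integral>x. f x \<partial>measure_average n (\<lambda>t. \<xi> t \<omega>)) \<longlonglongrightarrow> c"
      using L assms(7,8) unfolding c_bary by (simp add: limitin_weak_topology_iff bary)
    moreover have "\<forall>\<^sub>F n in sequentially. (\<integral>x. f x \<partial>measure_average n (\<lambda>t. \<xi> t \<omega>)) = A n \<omega>"
      using eventually_gt_at_top[of 0]
      by eventually_elim (simp only: A_def integral_measure_average[OF _ M1 f C])
    ultimately show "(\<lambda>n. A n \<omega>) \<longlonglongrightarrow> c"
      by (rule Lim_transform_eventually)
  qed
  have int_A: "integrable M (\<lambda>\<omega>. A n \<omega> - c)" for n
    using A_le by (intro Bochner_Integration.integrable_diff integrable_const integrable_const_bound[where B=C]) auto
  have "(\<lambda>n. \<integral>\<omega>. \<bar>A n \<omega> - c\<bar> \<partial>M) \<longlonglongrightarrow> (\<integral>\<omega>. 0 \<partial>M)"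
  proof (rule integral_dominated_convergence[where w="\<lambda>_. C + \<bar>c\<bar>"])
    show "AE \<omega> in M. (\<lambda>n. \<bar>A n \<omega> - c\<bar>) \<longlonglongrightarrow> 0"
      using A_lim by eventually_elim (simp add: tendsto_rabs_zero_iff LIM_zero_iff)
    show "AE \<omega> in M. norm \<bar>A n \<omega> - c\<bar> \<le> C + \<bar>c\<bar>" for n
    proof (rule AE_I2)
      fix \<omega> assume "\<omega> \<in> space M"
      then show "norm \<bar>A n \<omega> - c\<bar> \<le> C + \<bar>c\<bar>"
        using A_le[of \<omega> n] abs_triangle_ineq4[of "A n \<omega>" c] by simp
    qed
  qed auto
  then have A_L1: "(\<lambda>n. \<integral>\<omega>. \<bar>A n \<omega> - c\<bar> \<partial>M) \<longlonglongrightarrow> 0" by simp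

  let ?S = "\<lambda>n \<omega>. (1 / real n) * (\<Sum>i<n. f (X (\<tau> i) \<omega>))"
  have S_eq: "?S n \<omega> - c = deviation f n \<omega> + (A n \<omega> - c)" for n \<omega>
    by (simp add: deviation_def A_def Y_def sum_subtractf right_diff_distrib)
  note int_dev = integrable_deviation[OF f C]
  have "(\<lambda>n. \<integral>\<omega>. \<bar>?S n \<omega> - c\<bar> \<partial>M) \<longlonglongrightarrow> 0"
  proof (rule tendsto_sandwich[OF _ _ tendsto_const])
    have "(\<integral>\<omega>. \<bar>?S n \<omega> - c\<bar> \<partial>M) \<le> (\<integral>\<omega>. \<bar>deviation f n \<omega>\<bar> \<partial>M) + (\<integral>\<omega>. \<bar>A n \<omega> - c\<bar> \<partial>M)" for n
    proof -
      have "(\<integral>\<omega>. \<bar>?S n \<omega> - c\<bar> \<partial>M) \<le> (\<integral>\<omega>. \<bar>deviation f n \<omega>\<bar> + \<bar>A n \<omega> - c\<bar> \<partial>M)"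
        unfolding S_eq
        by (intro integral_mono integrable_abs Bochner_Integration.integrable_add int_dev int_A abs_triangle_ineq)
      also have "\<dots> = (\<integral>\<omega>. \<bar>deviation f n \<omega>\<bar> \<partial>M) + (\<integral>\<omega>. \<bar>A n \<omega> - c\<bar> \<partial>M)"
        by (intro Bochner_Integration.integral_add integrable_abs int_dev int_A)
      finally show ?thesis .
    qed
    then show "\<forall>\<^sub>F n in sequentially. (\<integral>\<omega>. \<bar>?S n \<omega> - c\<bar> \<partial>M) \<le>
        (\<integral>\<omega>. \<bar>deviation f n \<omega>\<bar> \<partial>M) + (\<integral>\<omega>. \<bar>A n \<omega> - c\<bar> \<partial>M)"
      by simp
    show "(\<lambda>n. (\<integral>\<omega>. \<bar>deviation f n \<omega>\<bar> \<partial>M) + (\<integral>\<omega>. \<bar>A n \<omega> - c\<bar> \<partial>M)) \<longlonglongrightarrow> 0"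
      using tendsto_add[OF dev A_L1] by simp
  qed simp
  then show ?thesis
    unfolding c_def[symmetric]
    by (rule converges_in_probability_L1[rotated])
      (unfold S_eq, intro Bochner_Integration.integrable_add int_dev int_A)
qed

end
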